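(* Consider the colouring algorithm in the beeping model $B_{cd}L$ described in the context (no knowledge of $n$, $\Delta$ or identifiers is given to the nodes). For any graph $G=(V,E)$ with $|V|=n$ and maximum degree $\Delta$, the algorithm colours all the nodes within $O(\Delta+\log n)$ phases with probability $1-o(n^{-1})$ (the constant in the $O$ and the $o(n^{-1})$ bound being uniform over all graphs $G$ with $n$ nodes, $n\to\infty$).
   Context: Beeping model: the network is a finite simple undirected graph $G=(V,E)$; nodes are anonymous, all run the same randomised algorithm (with independent random choices) and all start in the same slot. Time is divided into synchronous slots; in each slot every active node either beeps or listens. In $B_{cd}L$, a beeping node learns whether at least one neighbour beeped in the same slot (collision detection while beeping), and a listening node learns only whether at least one neighbour beeped. Algorithm (run by each node; each phase is one slot). Each node holds a beeping probability $p$, initially $1/2$, a colour, initially undefined, and a counter, initially $0$. In each phase, an uncoloured node beeps with probability $p$ (its current value), otherwise it listens. If it beeped and none of its neighbours beeped (an exclusive beep), it takes the current counter value as its colour and becomes passive (it no longer beeps). Otherwise: if nobody in its closed neighbourhood beeped, $p$ is replaced by $\min(2p,1/2)$; else $p$ is replaced by $p/2$; and the counter is incremented by $1$. *)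

theory Defs
  imports
    "HOL-Probability.Probability"
    "HOL-Library.Landau_Symbols"
    "Graph_Theory.Pair_Digraph"
begin

text \<open>
  Finite simple undirected graphs are modelled by \<^locale>\<open>pair_graph\<close>: a finite symmetric
  loop-free set of arcs on a finite vertex set. An undirected edge is a pair of opposite arcs, so
  the degree of a vertex is its out-degree.
\<close>

definition max_degree :: "'v pair_pre_digraph \<Rightarrow> nat" where
  "max_degree G = Max (insert 0 (out_degree (with_proj G) ` pverts G))"

text \<open>A node that has a colour is passive.\<close>

record node_state =
  beep_prob :: real
  colour :: "nat option"
  counter :: nat

definition initial_state :: node_state where
  "initial_state = \<lparr> beep_prob = 1/2, colour = None, counter = 0 \<rparr>"

definition beep_choice :: "node_state \<Rightarrow> bool pmf" where
  "beep_choice s = (if colour s = None then bernoulli_pmf (beep_prob s) else return_pmf False)"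

text \<open>
  End of a slot at one node: \<open>beeped\<close> is the node's own action and \<open>heard\<close> says whether at least
  one neighbour beeped. Both beeping and listening nodes obtain \<open>heard\<close> (collision detection
  while beeping), and it is the only information a node receives.
\<close>

definition node_update :: "bool \<Rightarrow> bool \<Rightarrow> node_state \<Rightarrow> node_state" where
  "node_update beeped heard s =
    (if colour s \<noteq> None then s
     else if beeped \<and> \<not> heard then s\<lparr>colour := Some (counter s)\<rparr>
     else s\<lparr>beep_prob := (if \<not> beeped \<and> \<not> heard then min (2 * beep_prob s) (1/2)
                         else beep_prob s / 2),
            counter := counter s + 1\<rparr>)"

text \<open>
  In each phase the nodes choose independently. Values of a configuration outside the vertex set
  play no role: such points are isolated and never beep.
\<close>

definition phase :: "'v pair_pre_digraph \<Rightarrow> ('v \<Rightarrow> node_state) \<Rightarrow> ('v \<Rightarrow> node_state) pmf" where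
  "phase G s =
    map_pmf (\<lambda>beeps v. node_update (beeps v) (\<exists>u. (v, u) \<in> parcs G \<and> beeps u) (s v))
      (Pi_pmf (pverts G) False (\<lambda>v. beep_choice (s v)))"

primrec run :: "'v pair_pre_digraph \<Rightarrow> nat \<Rightarrow> ('v \<Rightarrow> node_state) pmf" where
  "run G 0 = return_pmf (\<lambda>_. initial_state)"
| "run G (Suc t) = bind_pmf (run G t) (phase G)"

definition all_coloured :: "'v pair_pre_digraph \<Rightarrow> ('v \<Rightarrow> node_state) set" where
  "all_coloured G = {s. \<forall>v\<in>pverts G. colour (s v) \<noteq> None}"

end

theory Submission
  imports Defs
begin

text \<open>
  Fix a node \<open>v\<close> and let its load \<open>d\<close> be the sum of the beeping probabilities of its \<open>k\<close>
  uncoloured neighbours. As long as \<open>v\<close> is uncoloured, the potential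
  \<open>2 ^ k * ((1 + 200 * d) / sqrt p) powr \<alpha>\<close> shrinks by a constant factor in expectation in every
  phase. If the neighbours of bounded load contribute a constant to \<open>d\<close>, then one of them gets
  coloured with constant probability and \<open>k\<close> drops; if \<open>d\<close> is small and \<open>p > 1/4\<close>, then \<open>v\<close> itself
  gets coloured with constant probability; if \<open>d\<close> is not small and comes almost entirely from
  neighbours of large load, these halve their probabilities and \<open>d\<close> contracts; otherwise \<open>d\<close> is
  small, and \<open>p\<close> doubles. The potential starts at \<open>exp (O(\<Delta>))\<close> and is at least \<open>1\<close> while \<open>v\<close> is
  uncoloured, so Markov's inequality and a union bound over the nodes conclude.
\<close>

section \<open>Silence probabilities of independent beeps\<close>

text \<open>Weighted AM-GM for \<open>x\<close> and \<open>1\<close>. It replaces a power with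
  exponent \<alpha> by an affine function, so that it suffices to bound expectations of
  ratios.\<close>

lemma powr_le_tangent:
  fixes x a :: real
  assumes "0 < x" "0 \<le> a" "a \<le> 1"
  shows "x powr a \<le> 1 + a * (x - 1)"
  using Youngs_inequality_0[of a "1 - a" x 1] assms by (simp add: algebra_simps)

text \<open>On this range \<open>ln (1 - x)\<close> is at least \<open>- x - 2 * x^2\<close>, and
  \<open>2 * x^2 \<le> x\<close>.\<close>

lemma exp_le_one_minus:
  fixes x :: real
  assumes "0 \<le> x" "x \<le> 1/2"
  shows "exp (- 2 * x) \<le> 1 - x"
proof -
  have "x * x \<le> x * (1/2)"
    using assms by (intro mult_left_mono) auto
  then have "- 2 * x \<le> ln (1 - x)"
    using ln_one_minus_pos_lower_bound[of x] assms by (simp add: power2_eq_square)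
  then show ?thesis
    using assms by (subst ln_ge_iff[symmetric]) auto
qed

lemma exp_sum_le_prod_one_minus:
  fixes w :: "'a \<Rightarrow> real"
  assumes "\<And>x. x \<in> S \<Longrightarrow> 0 \<le> w x \<and> w x \<le> 1/2"
  shows "exp (- 2 * sum w S) \<le> (\<Prod>x\<in>S. 1 - w x)"
proof (cases "finite S")
  case True
  have "exp (- 2 * sum w S) = (\<Prod>x\<in>S. exp (- 2 * w x))"
    by (simp add: True exp_sum[symmetric] sum_distrib_left)
  also have "\<dots> \<le> (\<Prod>x\<in>S. 1 - w x)"
    using assms exp_le_one_minus by (intro prod_mono) auto
  finally show ?thesis .
qed auto

text \<open>Induction on \<open>S\<close>: for a new weight \<open>w\<close> and the old sum
  \<open>s\<close>, \<open>(1 - w) * (1 + w + s) = 1 + s - w * (w + s)\<close>.\<close>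

lemma prod_one_minus_le_inverse:
  fixes w :: "'a \<Rightarrow> real"
  assumes "\<And>x. x \<in> S \<Longrightarrow> 0 \<le> w x \<and> w x \<le> 1"
  shows "(\<Prod>x\<in>S. 1 - w x) \<le> 1 / (1 + sum w S)"
  using assms
proof (induction S rule: infinite_finite_induct)
  case (insert x S)
  have s: "0 \<le> sum w S"
    using insert.prems by (intro sum_nonneg) auto
  have w: "0 \<le> w x" "w x \<le> 1"
    using insert.prems by auto
  have "(\<Prod>x\<in>S. 1 - w x) \<le> 1 / (1 + sum w S)"
    using insert.prems by (intro insert.IH) auto
  then have "(1 - w x) * (\<Prod>x\<in>S. 1 - w x) \<le> (1 - w x) * (1 / (1 + sum w S))"
    using w by (intro mult_left_mono) auto
  then have "(\<Prod>x\<in>insert x S. 1 - w x) \<le> (1 - w x) * (1 / (1 + sum w S))"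
    using insert.hyps by simp
  also have "\<dots> \<le> 1 / (1 + sum w (insert x S))"
  proof -
    have "(1 - w x) * (1 + (w x + sum w S)) \<le> 1 + sum w S"
      using w s mult_nonneg_nonneg[of "w x" "sum w S"] by (simp add: algebra_simps)
    then show ?thesis
      using insert.hyps w s by (simp add: field_simps)
  qed
  finally show ?case .
qed auto

text \<open>Independence: the event is a product set with factor \<open>{True}\<close> at
  \<open>u\<close>, \<open>{False}\<close> on \<open>S\<close> and \<open>UNIV\<close>, of
  probability one, elsewhere.\<close>

lemma prob_beep_and_silent:
  assumes "finite V" "S \<subseteq> V" "u \<in> V" "u \<notin> S"
  shows "measure_pmf.prob (Pi_pmf V False q) {b. b u \<and> (\<forall>x\<in>S. \<not> b x)}
    = pmf (q u) True * (\<Prod>x\<in>S. pmf (q x) False)"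
proof -
  define B where "B x = (if x = u then {True} else if x \<in> S then {False} else UNIV)" for x
  have "{b. b u \<and> (\<forall>x\<in>S. \<not> b x)} = Pi V B"
    using assms by (fastforce simp: B_def Pi_iff split: if_splits)
  then have "measure_pmf.prob (Pi_pmf V False q) {b. b u \<and> (\<forall>x\<in>S. \<not> b x)}
      = (\<Prod>x\<in>V. measure_pmf.prob (q x) (B x))"
    using assms(1) by (simp add: measure_Pi_pmf_Pi)
  also have "\<dots> = (\<Prod>x\<in>insert u S. measure_pmf.prob (q x) (B x))"
    using assms by (intro prod.mono_neutral_right) (auto simp: B_def)
  also have "\<dots> = measure_pmf.prob (q u) (B u) * (\<Prod>x\<in>S. measure_pmf.prob (q x) (B x))"
    using assms finite_subset by (subst prod.insert) auto
  also have "\<dots> = pmf (q u) True * (\<Prod>x\<in>S. pmf (q x) False)"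
    using assms(4) by (auto simp: B_def measure_pmf_single intro!: prod.cong)
  finally show ?thesis .
qed

lemma prob_silent:
  assumes "finite V" "S \<subseteq> V"
  shows "measure_pmf.prob (Pi_pmf V False q) {b. \<forall>x\<in>S. \<not> b x} = (\<Prod>x\<in>S. pmf (q x) False)"
proof -
  define B where "B x = (if x \<in> S then {False} else UNIV)" for x
  have "{b. \<forall>x\<in>S. \<not> b x} = Pi V B"
    using assms by (fastforce simp: B_def Pi_iff split: if_splits)
  then have "measure_pmf.prob (Pi_pmf V False q) {b. \<forall>x\<in>S. \<not> b x}
      = (\<Prod>x\<in>V. measure_pmf.prob (q x) (B x))"
    using assms(1) by (simp add: measure_Pi_pmf_Pi)
  also have "\<dots> = (\<Prod>x\<in>S. measure_pmf.prob (q x) (B x))"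
    using assms by (intro prod.mono_neutral_right) (auto simp: B_def)
  also have "\<dots> = (\<Prod>x\<in>S. pmf (q x) False)"
    by (auto simp: B_def measure_pmf_single intro!: prod.cong)
  finally show ?thesis .
qed

text \<open>If elements are added one by one, the one with which the sum first reaches
  \<open>m\<close> overshoots by at most \<open>c\<close>. This serves to trim a set of competing
  nodes to a total weight that is bounded but not negligible.\<close>

lemma subset_sum_between:
  fixes w :: "'a \<Rightarrow> real"
  assumes "finite U" "m \<le> sum w U" "0 \<le> c" "0 \<le> m" "\<And>x. x \<in> U \<Longrightarrow> w x \<le> c"
  shows "\<exists>W\<subseteq>U. m \<le> sum w W \<and> sum w W \<le> m + c"
  using assms(1,2,5)
proof (induction U rule: finite_induct)
  case empty
  then show ?case
    using assms(3,4) by auto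
next
  case (insert x U)
  show ?case
  proof (cases "m \<le> sum w U")
    case True
    then obtain W where "W \<subseteq> U" "m \<le> sum w W" "sum w W \<le> m + c"
      using insert by auto
    then show ?thesis
      by blast
  next
    case False
    then have "sum w (insert x U) \<le> m + c"
      using insert by (force simp: sum.insert)
    then show ?thesis
      using insert.prems by blast
  qed
qed

section \<open>One phase\<close>

text \<open>In a valid configuration, the probability that the node beeps in the coming
  phase.\<close>

definition weight :: "node_state \<Rightarrow> real" where
  "weight s = (if colour s = None then beep_prob s else 0)"

text \<open>An invariant of every run. Positivity permits division by the root of a beeping
  probability \<open>p\<close>, and the cap 1/2 gives
  \<open>exp (- 2 * p) \<le> 1 - p\<close>.\<close>

definition valid :: "('v \<Rightarrow> node_state) \<Rightarrow> bool" where
  "valid s \<longleftrightarrow> (\<forall>v. 0 < beep_prob (s v) \<and> beep_prob (s v) \<le> 1/2)"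

definition nbrs :: "'v pair_pre_digraph \<Rightarrow> 'v \<Rightarrow> 'v set" where
  "nbrs G v = {u. (v, u) \<in> parcs G}"

definition load :: "'v pair_pre_digraph \<Rightarrow> ('v \<Rightarrow> node_state) \<Rightarrow> 'v \<Rightarrow> real" where
  "load G s v = (\<Sum>u\<in>nbrs G v. weight (s u))"

definition active_nbrs :: "'v pair_pre_digraph \<Rightarrow> ('v \<Rightarrow> node_state) \<Rightarrow> 'v \<Rightarrow> nat" where
  "active_nbrs G s v = card {u \<in> nbrs G v. colour (s u) = None}"

definition beeps :: "'v pair_pre_digraph \<Rightarrow> ('v \<Rightarrow> node_state) \<Rightarrow> ('v \<Rightarrow> bool) pmf" where
  "beeps G s = Pi_pmf (pverts G) False (\<lambda>v. beep_choice (s v))"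

text \<open>The deterministic part of a phase; expectations over a phase thus become expectations
  over independent coin flips.\<close>

definition step ::
  "'v pair_pre_digraph \<Rightarrow> ('v \<Rightarrow> node_state) \<Rightarrow> ('v \<Rightarrow> bool) \<Rightarrow> 'v \<Rightarrow> node_state" where
  "step G s b v = node_update (b v) (\<exists>u\<in>nbrs G v. b u) (s v)"

lemma phase_eq: "phase G s = map_pmf (step G s) (beeps G s)"
  unfolding phase_def beeps_def step_def nbrs_def
  by (intro arg_cong2[where f = map_pmf]) (auto simp: fun_eq_iff)

lemma weight_nonneg: "valid s \<Longrightarrow> 0 \<le> weight (s v)"
  and weight_le_half: "valid s \<Longrightarrow> weight (s v) \<le> 1/2"
  by (auto simp: valid_def weight_def less_imp_le)

lemma load_nonneg: "valid s \<Longrightarrow> 0 \<le> load G s v"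
  by (simp add: load_def sum_nonneg weight_nonneg)

lemma pmf_beep_choice:
  assumes "valid s"
  shows "pmf (beep_choice (s v)) True = weight (s v)"
    and "pmf (beep_choice (s v)) False = 1 - weight (s v)"
  using assms[unfolded valid_def, rule_format, of v] by (auto simp: beep_choice_def weight_def)

lemma valid_step: "valid s \<Longrightarrow> valid (step G s b)"
  unfolding valid_def
proof
  fix v
  assume "\<forall>v. 0 < beep_prob (s v) \<and> beep_prob (s v) \<le> 1/2"
  then have "0 < beep_prob (s v)" "beep_prob (s v) \<le> 1/2"
    by auto
  then show "0 < beep_prob (step G s b v) \<and> beep_prob (step G s b v) \<le> 1/2"
    by (auto simp: step_def node_update_def)
qed

lemma uncoloured_step: "colour (step G s b u) = None \<Longrightarrow> colour (s u) = None"
  by (cases "colour (s u)") (auto simp: step_def node_update_def)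

lemma exclusive_step:
  "b u \<Longrightarrow> \<forall>x\<in>nbrs G u. \<not> b x \<Longrightarrow> colour (step G s b u) \<noteq> None"
  by (auto simp: step_def node_update_def)

lemma weight_step_le: "valid s \<Longrightarrow> weight (step G s b u) \<le> 2 * weight (s u)"
  by (auto simp: step_def node_update_def weight_def valid_def less_imp_le)

lemma weight_step_le_half:
  assumes "valid s" "\<exists>x\<in>nbrs G u. b x"
  shows "weight (step G s b u) \<le> weight (s u) / 2"
  using assms by (auto simp: step_def node_update_def weight_def valid_def less_imp_le)

text \<open>A node that hears a beep at least halves its weight; otherwise the factor is at most
  \<open>2 = 1/2 + 3/2\<close>. Being affine in the indicator of silence, the bound can be
  integrated at once.\<close>

lemma weight_step_bound:
  assumes "valid s"
  shows "weight (step G s b u)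
    \<le> weight (s u) / 2 + 3/2 * weight (s u) * indicator {b. \<forall>x\<in>nbrs G u. \<not> b x} b"
proof (cases "\<exists>x\<in>nbrs G u. b x")
  case True
  then show ?thesis
    using weight_step_le_half[OF assms True] by (auto simp: indicator_def)
next
  case False
  then show ?thesis
    using weight_step_le[OF assms, of G b u] by (auto simp: indicator_def)
qed

text \<open>One twelfth of the lower bound on the probability that a new colour appears among sufficiently
  heavy light neighbours, so that this event outweighs the factor \<open>4 powr \<alpha> \<le> 1 + 3 * \<alpha>\<close> lost in
  the worst case.\<close>

definition \<alpha> :: real where
  "\<alpha> = 1/120000 * exp (-30)"

lemma \<alpha>_bounds: "0 < \<alpha>" "\<alpha> \<le> 1/120000"
  by (auto simp: \<alpha>_def)

section \<open>Probabilities of silence and of exclusive beeps in a graph\<close>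

context pair_graph
begin

lemma finite_nbrs: "finite (nbrs G v)"
  and nbrs_subset: "nbrs G v \<subseteq> pverts G"
  and not_self_nbr: "v \<notin> nbrs G v"
proof -
  show s: "nbrs G v \<subseteq> pverts G"
    by (auto simp: nbrs_def in_arcsD2)
  show "finite (nbrs G v)"
    using s pair_finite_verts finite_subset by blast
  show "v \<notin> nbrs G v"
    using pair_no_loops[of "(v, v)"] by (auto simp: nbrs_def)
qed

text \<open>Points outside the finite vertex set always take the default \<open>False\<close>, so
  there are finitely many beep patterns and every real function of them is integrable.\<close>

lemma finite_set_beeps: "finite (set_pmf (beeps G s))"
proof -
  have "set_pmf (beeps G s) \<subseteq> PiE_dflt (pverts G) False (\<lambda>_. UNIV)"
    using set_Pi_pmf_subset[OF pair_finite_verts] by (fastforce simp: beeps_def PiE_dflt_def)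
  moreover have "finite (PiE_dflt (pverts G) False (\<lambda>_. UNIV :: bool set))"
    by (intro finite_PiE_dflt pair_finite_verts) auto
  ultimately show ?thesis
    by (rule finite_subset)
qed

lemma integrable_beeps [simp]:
  fixes f :: "('a \<Rightarrow> bool) \<Rightarrow> real"
  shows "integrable (measure_pmf (beeps G s)) f"
  by (intro integrable_measure_pmf_finite finite_set_beeps)

lemma prob_nbrs_silent:
  assumes "valid s"
  shows "measure_pmf.prob (beeps G s) {b. \<forall>x\<in>nbrs G v. \<not> b x} = (\<Prod>x\<in>nbrs G v. 1 - weight (s x))"
  using prob_silent[OF pair_finite_verts nbrs_subset] pmf_beep_choice[OF assms]
  by (simp add: beeps_def)

lemma prob_nbrs_silent_le:
  assumes "valid s"
  shows "measure_pmf.prob (beeps G s) {b. \<forall>x\<in>nbrs G v. \<not> b x} \<le> 1 / (1 + load G s v)"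
proof -
  have "weight (s x) \<le> 1" for x
    using weight_le_half[OF assms, of x] by simp
  then show ?thesis
    unfolding prob_nbrs_silent[OF assms] load_def
    by (intro prod_one_minus_le_inverse) (auto simp: weight_nonneg assms)
qed

text \<open>Silence has probability at least \<open>exp (- 2 * d) \<ge> 1 - 2 * d\<close>, where
  \<open>d\<close> is the load.\<close>

lemma prob_heard_le:
  assumes "valid s"
  shows "measure_pmf.prob (beeps G s) {b. \<exists>x\<in>nbrs G v. b x} \<le> 2 * load G s v"
proof -
  have "1 - 2 * load G s v \<le> exp (- 2 * load G s v)"
    using exp_ge_add_one_self[of "- 2 * load G s v"] by simp
  also have "\<dots> \<le> measure_pmf.prob (beeps G s) {b. \<forall>x\<in>nbrs G v. \<not> b x}"
    unfolding prob_nbrs_silent[OF assms] load_def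
    by (intro exp_sum_le_prod_one_minus conjI weight_nonneg weight_le_half assms)
  also have "\<dots> = 1 - measure_pmf.prob (beeps G s) {b. \<exists>x\<in>nbrs G v. b x}"
    by (subst measure_pmf.prob_compl[symmetric]) (auto intro!: arg_cong[where f = "measure_pmf.prob _"])
  finally show ?thesis
    by simp
qed

text \<open>The set \<open>S\<close> is arbitrary so that it may contain, besides the neighbours of
  \<open>u\<close>, further competitors that are to stay silent.\<close>

lemma prob_beep_alone_ge:
  assumes "valid s" "u \<in> pverts G" "S \<subseteq> pverts G" "u \<notin> S"
  shows "weight (s u) * exp (- 2 * (\<Sum>x\<in>S. weight (s x)))
    \<le> measure_pmf.prob (beeps G s) {b. b u \<and> (\<forall>x\<in>S. \<not> b x)}"
proof -
  have "exp (- 2 * (\<Sum>x\<in>S. weight (s x))) \<le> (\<Prod>x\<in>S. 1 - weight (s x))"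
    by (intro exp_sum_le_prod_one_minus conjI weight_nonneg weight_le_half assms)
  then show ?thesis
    using assms weight_nonneg[OF assms(1)]
    by (simp add: beeps_def prob_beep_and_silent[OF pair_finite_verts] pmf_beep_choice mult_left_mono)
qed


text \<open>The threshold 14 is low enough for a light node to beep alone with probability at least
  a constant times its weight, and high enough that the neighbours of any other node are all silent
  with probability at most 1/15.\<close>

definition light :: "('a \<Rightarrow> node_state) \<Rightarrow> 'a \<Rightarrow> 'a set" where
  "light s v = {u \<in> nbrs G v. colour (s u) = None \<and> load G s u \<le> 14}"

definition newly_coloured :: "('a \<Rightarrow> node_state) \<Rightarrow> 'a \<Rightarrow> ('a \<Rightarrow> bool) \<Rightarrow> bool" where
  "newly_coloured s v b \<longleftrightarrow> (\<exists>u\<in>nbrs G v. colour (s u) = None \<and> colour (step G s b u) \<noteq> None)"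

text \<open>Exclusive beeps of different light neighbours can be made disjoint events, so that their
  probabilities add up to a constant multiple of the total weight.\<close>

lemma prob_newly_coloured_ge:
  assumes "valid s" "1/10000 \<le> (\<Sum>u\<in>light s v. weight (s u))"
  shows "1/10000 * exp (-30) \<le> measure_pmf.prob (beeps G s) {b. newly_coloured s v b}"
proof -
  have fin: "finite (light s v)"
    using finite_nbrs by (simp add: light_def)
  \<comment> \<open>Without this trimming the light neighbours could have unbounded total weight,
    and requiring all but one of them to be silent would be too costly.\<close>
  obtain W where W: "W \<subseteq> light s v" "1/10000 \<le> (\<Sum>u\<in>W. weight (s u))"
      "(\<Sum>u\<in>W. weight (s u)) \<le> 1/10000 + 1/2"
    using subset_sum_between[OF fin assms(2), of "1/2"] weight_le_half[OF assms(1)] by auto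
  have finW: "finite W"
    using W(1) fin finite_subset by blast
  have WV: "W \<subseteq> pverts G"
    using W(1) nbrs_subset by (auto simp: light_def)
  \<comment> \<open>Silence of the rest of \<open>W\<close> makes the events \<open>E u\<close>
    disjoint. The weight of \<open>S u\<close> is at most
    \<open>14 + 1/10000 + 1/2 \<le> 15\<close>, whence \<open>exp (-30)\<close>.\<close>
  define S where "S u = nbrs G u \<union> (W - {u})" for u
  define E where "E u = {b. b u \<and> (\<forall>x\<in>S u. \<not> b x)}" for u
  have prob_E: "weight (s u) * exp (-30) \<le> measure_pmf.prob (beeps G s) (E u)" if "u \<in> W" for u
  proof -
    have "(\<Sum>x\<in>S u. weight (s x)) \<le> (\<Sum>x\<in>nbrs G u. weight (s x)) + (\<Sum>x\<in>W - {u}. weight (s x))"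
      unfolding S_def using finite_nbrs finW weight_nonneg[OF assms(1)]
      by (subst sum.union_inter[symmetric]) (auto intro!: sum_nonneg)
    also have "\<dots> \<le> load G s u + (\<Sum>x\<in>W. weight (s x))"
      unfolding load_def using finW weight_nonneg[OF assms(1)]
      by (intro add_left_mono sum_mono2) auto
    also have "\<dots> \<le> 15"
      using that W by (auto simp: light_def)
    finally have "exp (-30) \<le> exp (- 2 * (\<Sum>x\<in>S u. weight (s x)))"
      by simp
    then have "weight (s u) * exp (-30) \<le> weight (s u) * exp (- 2 * (\<Sum>x\<in>S u. weight (s x)))"
      using weight_nonneg[OF assms(1)] by (intro mult_left_mono)
    also have "\<dots> \<le> measure_pmf.prob (beeps G s) (E u)"
      unfolding E_def using that WV nbrs_subset not_self_nbr
      by (intro prob_beep_alone_ge assms(1)) (auto simp: S_def)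
    finally show ?thesis .
  qed
  have disj: "disjoint_family_on E W"
    by (auto simp: disjoint_family_on_def E_def S_def)
  have "1/10000 * exp (-30) \<le> (\<Sum>u\<in>W. weight (s u)) * exp (-30)"
    using W by (intro mult_right_mono) auto
  also have "\<dots> \<le> (\<Sum>u\<in>W. measure_pmf.prob (beeps G s) (E u))"
    unfolding sum_distrib_right using prob_E by (intro sum_mono)
  also have "\<dots> = measure_pmf.prob (beeps G s) (\<Union>u\<in>W. E u)"
    using disj finW by (intro measure_pmf.finite_measure_finite_Union[symmetric]) auto
  also have "\<dots> \<le> measure_pmf.prob (beeps G s) {b. newly_coloured s v b}"
  proof (intro measure_pmf.finite_measure_mono subsetI)
    fix b
    assume "b \<in> (\<Union>u\<in>W. E u)"
    then obtain u where u: "u \<in> W" "b \<in> E u"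
      by blast
    then have "colour (step G s b u) \<noteq> None"
      by (intro exclusive_step) (auto simp: E_def S_def)
    then show "b \<in> {b. newly_coloured s v b}"
      using u(1) W(1) by (auto simp: newly_coloured_def light_def)
  qed auto
  finally show ?thesis .
qed

lemma active_nbrs_step_le: "active_nbrs G (step G s b) v \<le> active_nbrs G s v"
  unfolding active_nbrs_def using finite_nbrs by (intro card_mono) (auto dest: uncoloured_step)

lemma active_nbrs_step_less:
  assumes "newly_coloured s v b"
  shows "active_nbrs G (step G s b) v < active_nbrs G s v"
  unfolding active_nbrs_def
proof (rule psubset_card_mono)
  show "finite {u \<in> nbrs G v. colour (s u) = None}"
    using finite_nbrs by simp
  obtain u where u: "u \<in> nbrs G v" "colour (s u) = None" "colour (step G s b u) \<noteq> None"
    using assms unfolding newly_coloured_def by blast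
  show "{u \<in> nbrs G v. colour (step G s b u) = None} \<subset> {u \<in> nbrs G v. colour (s u) = None}"
  proof (rule psubsetI)
    show "{u \<in> nbrs G v. colour (step G s b u) = None} \<subseteq> {u \<in> nbrs G v. colour (s u) = None}"
      by (auto dest: uncoloured_step)
    have "u \<in> {u \<in> nbrs G v. colour (s u) = None}"
      using u by simp
    moreover have "u \<notin> {u \<in> nbrs G v. colour (step G s b u) = None}"
      using u by simp
    ultimately show "{u \<in> nbrs G v. colour (step G s b u) = None} \<noteq> {u \<in> nbrs G v. colour (s u) = None}"
      by metis
  qed
qed

section \<open>Expected contraction of the load\<close>

lemma load_step_le: "valid s \<Longrightarrow> load G (step G s b) v \<le> 2 * load G s v"
  by (auto simp: load_def sum_distrib_left intro!: sum_mono weight_step_le)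

text \<open>A node of load above \<open>14\<close> is unlikely to be in a silent neighbourhood, so its weight
  nearly halves on average.\<close>

lemma expectation_weight_step_le:
  assumes "valid s" "14 < load G s u"
  shows "measure_pmf.expectation (beeps G s) (\<lambda>b. weight (step G s b u)) \<le> 3/5 * weight (s u)"
proof -
  let ?A = "{b. \<forall>x\<in>nbrs G u. \<not> b x}"
  have "measure_pmf.prob (beeps G s) ?A \<le> 1/15"
  proof -
    have "1 / (1 + load G s u) \<le> 1/15"
      using assms(2) by (simp add: field_simps)
    then show ?thesis
      using prob_nbrs_silent_le[OF assms(1), of u] by linarith
  qed
  \<comment> \<open>The factor 3/5 is \<open>1/2 + 3/2 * (1/15)\<close>.\<close>
  then have *: "3/2 * weight (s u) * measure_pmf.prob (beeps G s) ?A \<le> 3/2 * weight (s u) * (1/15)"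
    using weight_nonneg[OF assms(1), of u] by (intro mult_left_mono) auto
  have "measure_pmf.expectation (beeps G s) (\<lambda>b. weight (step G s b u))
      \<le> measure_pmf.expectation (beeps G s)
          (\<lambda>b. weight (s u) / 2 + 3/2 * weight (s u) * indicator ?A b)"
    using weight_step_bound[OF assms(1)] by (intro integral_mono) auto
  also have "\<dots> = weight (s u) / 2 + 3/2 * weight (s u) * measure_pmf.prob (beeps G s) ?A"
    by (subst Bochner_Integration.integral_add) auto
  finally show ?thesis
    using * by simp
qed

text \<open>Active neighbours that are not light contract by 3/5 on average, and coloured ones have
  weight zero. For light ones only the worst case \<open>2 = 3/5 + 7/5\<close> is used.\<close>

lemma expectation_load_step_le:
  assumes "valid s"
  shows "measure_pmf.expectation (beeps G s) (\<lambda>b. load G (step G s b) v)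
    \<le> 3/5 * load G s v + 7/5 * (\<Sum>u\<in>light s v. weight (s u))"
proof -
  have *: "measure_pmf.expectation (beeps G s) (\<lambda>b. weight (step G s b u))
      \<le> 3/5 * weight (s u) + 7/5 * (if u \<in> light s v then weight (s u) else 0)"
    if "u \<in> nbrs G v" for u
  proof (cases "u \<in> light s v")
    case True
    have "measure_pmf.expectation (beeps G s) (\<lambda>b. weight (step G s b u))
        \<le> measure_pmf.expectation (beeps G s) (\<lambda>_. 2 * weight (s u))"
      using weight_step_le[OF assms] by (intro integral_mono) auto
    then show ?thesis
      using True by simp
  next
    case False
    show ?thesis
    proof (cases "colour (s u) = None")
      case True
      then show ?thesis
        using False that expectation_weight_step_le[OF assms, of u] by (auto simp: light_def)
    next
      case 2: False
      then have "weight (s u) = 0" "weight (step G s b u) = 0" for b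
        using uncoloured_step[of G s b u] by (auto simp: weight_def)
      then show ?thesis
        by simp
    qed
  qed
  have "measure_pmf.expectation (beeps G s) (\<lambda>b. load G (step G s b) v)
      = (\<Sum>u\<in>nbrs G v. measure_pmf.expectation (beeps G s) (\<lambda>b. weight (step G s b u)))"
    unfolding load_def by (intro Bochner_Integration.integral_sum) auto
  also have "\<dots> \<le> (\<Sum>u\<in>nbrs G v.
      3/5 * weight (s u) + 7/5 * (if u \<in> light s v then weight (s u) else 0))"
    using * by (intro sum_mono)
  also have "\<dots> = 3/5 * load G s v + 7/5 * (\<Sum>u\<in>nbrs G v. if u \<in> light s v then weight (s u) else 0)"
    by (simp add: load_def sum.distrib sum_distrib_left)
  also have "(\<Sum>u\<in>nbrs G v. if u \<in> light s v then weight (s u) else 0)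
      = (\<Sum>u\<in>light s v. weight (s u))"
    using finite_nbrs by (subst sum.inter_restrict[symmetric])
      (auto simp: light_def intro!: sum.cong)
  finally show ?thesis .
qed


section \<open>The potential\<close>

text \<open>The summand 1 damps changes of a small load. With the factor 200, a load of 1/20 already
  dominates it, while light weight below 1/10000 adds at most 0.028 to the expected
  numerator.\<close>

definition base :: "('a \<Rightarrow> node_state) \<Rightarrow> 'a \<Rightarrow> real" where
  "base s v = (1 + 200 * load G s v) / sqrt (beep_prob (s v))"

definition potential :: "('a \<Rightarrow> node_state) \<Rightarrow> 'a \<Rightarrow> real" where
  "potential s v = (if colour (s v) = None then 2 ^ active_nbrs G s v * base s v powr \<alpha> else 0)"

lemma base_ge_1:
  assumes "valid s"
  shows "1 \<le> base s v"
proof -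
  have p: "0 < beep_prob (s v)" "beep_prob (s v) \<le> 1"
    using assms by (auto simp: valid_def intro: order_trans[of _ "1/2"])
  then have "sqrt (beep_prob (s v)) \<le> 1"
    by simp
  then have "sqrt (beep_prob (s v)) \<le> 1 + 200 * load G s v"
    using load_nonneg[OF assms, of G v] by linarith
  then show ?thesis
    using p by (simp add: base_def)
qed

lemma potential_ge_1:
  assumes "valid s" "colour (s v) = None"
  shows "1 \<le> potential s v"
proof -
  have "1 * 1 \<le> 2 ^ active_nbrs G s v * base s v powr \<alpha>"
    using base_ge_1[OF assms(1)] \<alpha>_bounds by (intro mult_mono ge_one_powr_ge_zero) auto
  then show ?thesis
    using assms(2) by (simp add: potential_def)
qed

text \<open>The beeping probability at worst halves, which costs the factor
  \<open>sqrt 2\<close>.\<close>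

lemma base_step_le_load:
  assumes "valid s"
  shows "base (step G s b) v
    \<le> sqrt 2 * ((1 + 200 * load G (step G s b) v) / (1 + 200 * load G s v)) * base s v"
proof -
  have "0 < beep_prob (s v)" "beep_prob (s v) \<le> 1/2"
    using assms by (auto simp: valid_def)
  then have p: "0 < beep_prob (s v)" "beep_prob (s v) / 2 \<le> beep_prob (step G s b v)"
    by (auto simp: step_def node_update_def min_def)
  have "base (step G s b) v \<le> (1 + 200 * load G (step G s b) v) / sqrt (beep_prob (s v) / 2)"
    unfolding base_def using p load_nonneg[OF valid_step[OF assms], of G G b v]
    by (intro divide_left_mono) auto
  also have "\<dots> = sqrt 2 * ((1 + 200 * load G (step G s b) v) / (1 + 200 * load G s v)) * base s v"
    using load_nonneg[OF assms, of G v] by (simp add: base_def real_sqrt_divide)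
  finally show ?thesis .
qed

lemma load_ratio_le_2:
  assumes "valid s"
  shows "(1 + 200 * load G (step G s b) v) / (1 + 200 * load G s v) \<le> 2"
  using load_step_le[OF assms, of b v] load_nonneg[OF assms, of G v] by (simp add: field_simps)

lemma base_step_le:
  assumes "valid s"
  shows "base (step G s b) v \<le> 4 * base s v"
proof -
  have "sqrt 2 * ((1 + 200 * load G (step G s b) v) / (1 + 200 * load G s v)) \<le> 2 * 2"
    using load_ratio_le_2[OF assms, of b v] load_nonneg[OF assms, of G v]
      load_nonneg[OF valid_step[OF assms], of G G b v] real_sqrt_le_mono[of 2 4]
    by (intro mult_mono) auto
  then have "sqrt 2 * ((1 + 200 * load G (step G s b) v) / (1 + 200 * load G s v)) * base s v
      \<le> 4 * base s v"
    using base_ge_1[OF assms, of v] by (intro mult_right_mono) auto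
  then show ?thesis
    using base_step_le_load[OF assms, of b v] by linarith
qed

text \<open>If \<open>v\<close> had beeped amid silent neighbours, it would now be coloured; so it
  listened. As its probability is at most 1/4, the cap 1/2 does not prevent a full doubling.\<close>

lemma base_step_silent:
  assumes "valid s" "beep_prob (s v) \<le> 1/4" "\<forall>x\<in>nbrs G v. \<not> b x"
    and "colour (step G s b v) = None"
  shows "base (step G s b) v
    = sqrt 2 / 2 * ((1 + 200 * load G (step G s b) v) / (1 + 200 * load G s v)) * base s v"
proof -
  have "colour (s v) = None"
    using assms(4) uncoloured_step by metis
  moreover have "\<not> b v"
    using assms(3,4) exclusive_step by metis
  ultimately have "beep_prob (step G s b v) = 2 * beep_prob (s v)"
    using assms(2,3) by (auto simp: step_def node_update_def)
  then have "base (step G s b) v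
      = (1 + 200 * load G (step G s b) v) / (sqrt 2 * sqrt (beep_prob (s v)))"
    by (simp add: base_def real_sqrt_mult)
  also have "\<dots> = 1 / sqrt 2 * ((1 + 200 * load G (step G s b) v) / (1 + 200 * load G s v)) * base s v"
    using load_nonneg[OF assms(1), of G v] by (simp add: base_def)
  also have "1 / sqrt 2 = sqrt 2 / 2"
    using real_div_sqrt[of 2] by (simp add: field_simps)
  finally show ?thesis .
qed

text \<open>The exponent \<open>1/2\<close> of the beeping probability balances the two cases: under a large load the
  contraction of the load outweighs a halving of the probability, and under a small load the
  probability doubles while the load grows negligibly.\<close>

lemma expectation_base_ratio_le:
  assumes "valid s" "(\<Sum>u\<in>light s v. weight (s u)) < 1/10000"
    and "1/20 \<le> load G s v \<or> beep_prob (s v) \<le> 1/4"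
  shows "measure_pmf.expectation (beeps G s)
      (\<lambda>b. if colour (step G s b v) = None then base (step G s b) v / base s v else 0) \<le> 19/20"
proof -
  let ?E = "measure_pmf.expectation (beeps G s)"
  let ?R = "\<lambda>b. if colour (step G s b v) = None then base (step G s b) v / base s v else 0"
  define X where "X b = (1 + 200 * load G (step G s b) v) / (1 + 200 * load G s v)" for b
  define d where "d = load G s v"
  have d: "0 \<le> d"
    using load_nonneg[OF assms(1)] by (simp add: d_def)
  have bs: "0 < base s v"
    using base_ge_1[OF assms(1), of v] by simp
  have sqrt2: "sqrt 2 \<le> 1.4143"
    by (rule real_le_lsqrt) (auto simp: power2_eq_square)
  have X_nonneg: "0 \<le> X b" for b
    using d load_nonneg[OF valid_step[OF assms(1)], of G G b v] by (simp add: X_def d_def)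
  have X_le: "X b \<le> 2" for b
    unfolding X_def by (rule load_ratio_le_2[OF assms(1)])
  have R_le: "?R b \<le> sqrt 2 * X b" for b
  proof -
    have "base (step G s b) v / base s v \<le> sqrt 2 * X b"
      using base_step_le_load[OF assms(1), of b v] bs by (subst pos_divide_le_eq) (auto simp: X_def)
    then show ?thesis
      using X_nonneg[of b] by auto
  qed
  \<comment> \<open>Here \<open>1.028 = 1 + 200 * (7/5) * (1/10000)\<close> and
    \<open>120 = 200 * (3/5)\<close>.\<close>
  have "?E X = (1 + 200 * ?E (\<lambda>b. load G (step G s b) v)) / (1 + 200 * d)"
    unfolding X_def d_def by simp
  also have "\<dots> \<le> (1 + 200 * (3/5 * d + 7/5 * (1/10000))) / (1 + 200 * d)"
    using expectation_load_step_le[OF assms(1), of v] assms(2) d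
    by (intro divide_right_mono) (auto simp: d_def)
  finally have EX: "?E X \<le> (1.028 + 120 * d) / (1 + 200 * d)"
    by simp
  show ?thesis
  proof (cases "1/20 \<le> d")
    case True
    have "?E ?R \<le> ?E (\<lambda>b. sqrt 2 * X b)"
      using R_le by (intro integral_mono) auto
    also have "\<dots> \<le> 1.4143 * ((1.028 + 120 * d) / (1 + 200 * d))"
      unfolding integral_mult_right_zero using EX sqrt2 X_nonneg
      by (intro mult_mono integral_nonneg) auto
    \<comment> \<open>The quotient decreases in \<open>d\<close>; at \<open>d = 1/20\<close> the
      bound is about 0.904.\<close>
    also have "\<dots> \<le> 19/20"
      using True by (simp add: field_simps)
    finally show ?thesis .
  next
    case False
    then have p: "beep_prob (s v) \<le> 1/4"
      using assms(3) by (simp add: d_def)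
    let ?H = "{b. \<exists>x\<in>nbrs G v. b x}"
    \<comment> \<open>If a neighbour beeps, the general bound \<open>sqrt 2 * X b\<close> is used;
      its excess over the silent case is \<open>sqrt 2 / 2 * X b\<close>, at most
      \<open>sqrt 2\<close> because \<open>X b \<le> 2\<close>.\<close>
    have R_le': "?R b \<le> sqrt 2 / 2 * X b + sqrt 2 * indicator ?H b" for b
    proof (cases "b \<in> ?H")
      case True
      have "sqrt 2 / 2 * X b \<le> sqrt 2 / 2 * 2"
        using X_le by (intro mult_left_mono) auto
      then have "sqrt 2 * X b \<le> sqrt 2 / 2 * X b + sqrt 2"
        by (simp add: field_simps)
      also have "\<dots> = sqrt 2 / 2 * X b + sqrt 2 * indicator ?H b"
        using True by (simp add: indicator_def)
      finally show ?thesis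
        using R_le[of b] by linarith
    next
      case False
      then have "?R b \<le> sqrt 2 / 2 * X b"
        using base_step_silent[OF assms(1) p, of b, folded X_def] bs X_nonneg[of b] by simp
      then show ?thesis
        using False by (simp add: indicator_def)
    qed
    have "?E ?R \<le> ?E (\<lambda>b. sqrt 2 / 2 * X b + sqrt 2 * indicator ?H b)"
      using R_le' by (intro integral_mono) auto
    also have "\<dots> = sqrt 2 * (?E X / 2 + measure_pmf.prob (beeps G s) ?H)"
      by (subst Bochner_Integration.integral_add) (auto simp: algebra_simps)
    also have "\<dots> \<le> sqrt 2 * (1.028 / 2 + 1/10)"
    proof (intro mult_left_mono add_mono)
      have "(1.028 + 120 * d) / (1 + 200 * d) \<le> 1.028"
        using d by (simp add: field_simps)
      with EX have "?E X \<le> 1.028"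
        by (rule order_trans)
      then show "?E X / 2 \<le> 1.028 / 2"
        by (rule divide_right_mono) simp
      show "measure_pmf.prob (beeps G s) ?H \<le> 1/10"
        using prob_heard_le[OF assms(1), of v] False by (simp add: d_def)
    qed auto
    also have "\<dots> \<le> 1.4143 * (1.028 / 2 + 1/10)"
      using sqrt2 by (intro mult_right_mono) auto
    finally show ?thesis
      by simp
  qed
qed

section \<open>Expected decay of the potential\<close>

lemma potential_step_le:
  assumes "valid s" "colour (s v) = None" "colour (step G s b v) = None"
  shows "potential (step G s b) v \<le> 2 ^ active_nbrs G (step G s b) v * ((1 + 3 * \<alpha>) * base s v powr \<alpha>)"
proof -
  have b: "1 \<le> base s v" "1 \<le> base (step G s b) v"
    using base_ge_1 valid_step assms(1) by blast+
  have "base (step G s b) v powr \<alpha> \<le> (4 * base s v) powr \<alpha>"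
    using base_step_le[OF assms(1)] b \<alpha>_bounds by (intro powr_mono2) auto
  also have "\<dots> = 4 powr \<alpha> * base s v powr \<alpha>"
    by (rule powr_mult)
  also have "\<dots> \<le> (1 + 3 * \<alpha>) * base s v powr \<alpha>"
    using powr_le_tangent[of 4 \<alpha>] \<alpha>_bounds by (intro mult_right_mono) auto
  finally show ?thesis
    using assms(3) by (auto simp: potential_def intro!: mult_left_mono)
qed

lemma expectation_potential_step_le:
  assumes "valid s" "v \<in> pverts G"
  shows "measure_pmf.expectation (beeps G s) (\<lambda>b. potential (step G s b) v)
    \<le> (1 - \<alpha> / 20) * potential s v"
proof (cases "colour (s v) = None")
  case False
  then have "potential (step G s b) v = 0" for b
    using uncoloured_step[of G s b v] by (auto simp: potential_def)
  moreover have "potential s v = 0"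
    using False by (auto simp: potential_def)
  ultimately show ?thesis
    by simp
next
  case active: True
  define K where "K = (2::real) ^ active_nbrs G s v"
  define P where "P = potential s v"
  have P_eq: "P = K * base s v powr \<alpha>"
    using active by (simp add: P_def K_def potential_def)
  have P: "1 \<le> P"
    unfolding P_def by (rule potential_ge_1[OF assms(1) active])
  have bs: "1 \<le> base s v"
    using base_ge_1[OF assms(1)] .
  have K_step: "2 ^ active_nbrs G (step G s b) v \<le> K" for b
    unfolding K_def by (intro power_increasing active_nbrs_step_le) auto
  let ?E = "measure_pmf.expectation (beeps G s)"
  let ?F = "\<lambda>b. potential (step G s b) v"
  have F_le: "?F b \<le> (1 + 3 * \<alpha>) * P" for b
  proof (cases "colour (step G s b v) = None")
    case True
    have "?F b \<le> 2 ^ active_nbrs G (step G s b) v * ((1 + 3 * \<alpha>) * base s v powr \<alpha>)"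
      by (rule potential_step_le[OF assms(1) active True])
    also have "\<dots> \<le> K * ((1 + 3 * \<alpha>) * base s v powr \<alpha>)"
      using \<alpha>_bounds K_step by (intro mult_right_mono) auto
    finally show ?thesis
      by (simp add: P_eq algebra_simps)
  qed (use \<alpha>_bounds P in \<open>auto simp: potential_def\<close>)
  \<comment> \<open>Every phase costs at most the factor \<open>1 + 3 * \<alpha>\<close>. An event
    \<open>A\<close> that saves a further fraction \<open>c\<close> pays for this, as \<open>(1 + 3
    * \<alpha>) * (1 - 6 * \<alpha>) \<le> 1 - 3 * \<alpha>\<close>.\<close>
  have lucky: "?E ?F \<le> (1 - \<alpha> / 20) * P"
    if le: "\<And>b. b \<in> A \<Longrightarrow> ?F b \<le> (1 + 3 * \<alpha>) * (P * (1 - c))"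
      and c: "0 \<le> c" and q: "6 * \<alpha> \<le> c * measure_pmf.prob (beeps G s) A" for A c
  proof -
    have "?F b \<le> (1 + 3 * \<alpha>) * P * (1 - c * indicator A b)" for b
      using le[of b] F_le[of b] by (auto simp: indicator_def algebra_simps)
    then have "?E ?F \<le> ?E (\<lambda>b. (1 + 3 * \<alpha>) * P * (1 - c * indicator A b))"
      by (intro integral_mono) auto
    also have "\<dots> = (1 + 3 * \<alpha>) * P * (1 - c * measure_pmf.prob (beeps G s) A)"
      by simp
    also have "\<dots> \<le> (1 + 3 * \<alpha>) * P * (1 - 6 * \<alpha>)"
      using q P \<alpha>_bounds by (intro mult_left_mono) auto
    also have "\<dots> = ((1 + 3 * \<alpha>) * (1 - 6 * \<alpha>)) * P"
      by (simp add: algebra_simps)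
    also have "\<dots> \<le> (1 - \<alpha> / 20) * P"
    proof (rule mult_right_mono)
      show "(1 + 3 * \<alpha>) * (1 - 6 * \<alpha>) \<le> 1 - \<alpha> / 20"
        using \<alpha>_bounds mult_nonneg_nonneg[of \<alpha> \<alpha>] by (simp add: algebra_simps)
    qed (use P in simp)
    finally show ?thesis .
  qed
  consider (light) "1/10000 \<le> (\<Sum>u\<in>light s v. weight (s u))"
    | (ready) "load G s v < 1/20" "1/4 < beep_prob (s v)"
    | (drift) "(\<Sum>u\<in>light s v. weight (s u)) < 1/10000"
        "1/20 \<le> load G s v \<or> beep_prob (s v) \<le> 1/4"
    by linarith
  then have "?E ?F \<le> (1 - \<alpha> / 20) * P"
  proof cases
    case light
    show ?thesis
    proof (rule lucky[of "{b. newly_coloured s v b}" "1/2"])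
      fix b
      assume "b \<in> {b. newly_coloured s v b}"
      then have "active_nbrs G (step G s b) v + 1 \<le> active_nbrs G s v"
        using active_nbrs_step_less[of s v b] by simp
      then have "(2::real) ^ (active_nbrs G (step G s b) v + 1) \<le> K"
        unfolding K_def by (intro power_increasing) auto
      then have k: "2 ^ active_nbrs G (step G s b) v \<le> K / 2"
        by simp
      show "?F b \<le> (1 + 3 * \<alpha>) * (P * (1 - 1/2))"
      proof (cases "colour (step G s b v) = None")
        case True
        have "?F b \<le> 2 ^ active_nbrs G (step G s b) v * ((1 + 3 * \<alpha>) * base s v powr \<alpha>)"
          by (rule potential_step_le[OF assms(1) active True])
        also have "\<dots> \<le> K / 2 * ((1 + 3 * \<alpha>) * base s v powr \<alpha>)"
          using \<alpha>_bounds k by (intro mult_right_mono) auto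
        finally show ?thesis
          by (simp add: P_eq algebra_simps)
      qed (use \<alpha>_bounds P in \<open>auto simp: potential_def\<close>)
    next
      \<comment> \<open>By the choice of \<alpha>, the event has probability at least
        \<open>12 * \<alpha>\<close>.\<close>
      show "6 * \<alpha> \<le> 1/2 * measure_pmf.prob (beeps G s) {b. newly_coloured s v b}"
        using prob_newly_coloured_ge[OF assms(1) light] by (simp add: \<alpha>_def)
    qed auto
  next
    case ready
    let ?A = "{b. b v \<and> (\<forall>x\<in>nbrs G v. \<not> b x)}"
    show ?thesis
    proof (rule lucky[of ?A 1])
      fix b
      assume "b \<in> ?A"
      then have "?F b = 0"
        using exclusive_step[of b v G s] by (auto simp: potential_def)
      then show "?F b \<le> (1 + 3 * \<alpha>) * (P * (1 - 1))"
        by simp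
    next
      have "1/4 * (1 - 2 * (1/20)) \<le> weight (s v) * exp (- 2 * load G s v)"
        using ready active exp_ge_add_one_self[of "- 2 * load G s v"]
        by (intro mult_mono) (auto simp: weight_def)
      also have "\<dots> \<le> measure_pmf.prob (beeps G s) ?A"
        using prob_beep_alone_ge[OF assms nbrs_subset not_self_nbr] by (simp add: load_def)
      finally show "6 * \<alpha> \<le> 1 * measure_pmf.prob (beeps G s) ?A"
        using \<alpha>_bounds by simp
    qed auto
  next
    case drift
    define R where "R b = (if colour (step G s b v) = None then base (step G s b) v / base s v else 0)" for b
    \<comment> \<open>The tangent bound makes the estimate affine in the ratio \<open>R b\<close>,
      so its expectation is all that matters. The value 0 for a coloured \<open>v\<close> is
      consistent, since the potential then vanishes.\<close>
    have "?F b \<le> P * (1 - \<alpha> + \<alpha> * R b)" for b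
    proof (cases "colour (step G s b v) = None")
      case True
      have R: "0 < R b" "base (step G s b) v = R b * base s v"
        using True bs base_ge_1[OF valid_step[OF assms(1)], of G b v] by (auto simp: R_def)
      have "?F b = 2 ^ active_nbrs G (step G s b) v * (R b powr \<alpha> * base s v powr \<alpha>)"
        using True R(1) bs by (simp add: potential_def R(2) powr_mult)
      also have "\<dots> \<le> K * (R b powr \<alpha> * base s v powr \<alpha>)"
        using K_step by (intro mult_right_mono) auto
      also have "\<dots> = P * R b powr \<alpha>"
        by (simp add: P_eq)
      also have "\<dots> \<le> P * (1 + \<alpha> * (R b - 1))"
        using powr_le_tangent[OF R(1), of \<alpha>] \<alpha>_bounds P by (intro mult_left_mono) auto
      finally show ?thesis
        by (simp add: algebra_simps)
    next
      case False
      then have "?F b = 0" "R b = 0"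
        by (auto simp: potential_def R_def)
      then show ?thesis
        using P \<alpha>_bounds by simp
    qed
    then have "?E ?F \<le> ?E (\<lambda>b. P * (1 - \<alpha> + \<alpha> * R b))"
      by (intro integral_mono) auto
    also have "\<dots> = P * (1 - \<alpha> + \<alpha> * ?E R)"
      by simp
    \<comment> \<open>This case determines the overall rate
      \<open>1 - \<alpha> / 20\<close>.\<close>
    also have "\<dots> \<le> P * (1 - \<alpha> + \<alpha> * (19/20))"
      using expectation_base_ratio_le[OF assms(1) drift, folded R_def] P \<alpha>_bounds
      by (intro mult_left_mono add_left_mono) auto
    finally show ?thesis
      by (simp add: algebra_simps)
  qed
  then show ?thesis
    by (simp add: P_def)
qed

section \<open>The whole run\<close>

lemma finite_set_run: "finite (set_pmf (run G t))"
  by (induction t) (auto simp: phase_eq finite_set_beeps)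

lemma valid_run: "s \<in> set_pmf (run G t) \<Longrightarrow> valid s"
proof (induction t arbitrary: s)
  case 0
  then show ?case
    by (simp add: valid_def initial_state_def)
next
  case (Suc t)
  then show ?case
    by (auto simp: phase_eq intro: valid_step)
qed

lemma expectation_potential_run_le:
  assumes "v \<in> pverts G"
  shows "measure_pmf.expectation (run G t) (\<lambda>s. potential s v)
    \<le> (1 - \<alpha> / 20) ^ t * potential (\<lambda>_. initial_state) v"
proof (induction t)
  case (Suc t)
  let ?A = "set_pmf (run G t)"
  have "measure_pmf.expectation (run G (Suc t)) (\<lambda>s. potential s v)
      = (\<Sum>s\<in>?A. pmf (run G t) s * measure_pmf.expectation (phase G s) (\<lambda>s. potential s v))"
    using finite_set_run by (simp add: pmf_expectation_bind[of ?A] phase_eq finite_set_beeps)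
  also have "\<dots> \<le> (\<Sum>s\<in>?A. pmf (run G t) s * ((1 - \<alpha> / 20) * potential s v))"
    using expectation_potential_step_le[OF valid_run assms]
    by (intro sum_mono mult_left_mono) (auto simp: phase_eq)
  also have "\<dots> = (1 - \<alpha> / 20) * measure_pmf.expectation (run G t) (\<lambda>s. potential s v)"
    using finite_set_run
    by (simp add: integral_measure_pmf_real[of ?A] sum_distrib_left mult_ac)
  also have "\<dots> \<le> (1 - \<alpha> / 20) * ((1 - \<alpha> / 20) ^ t * potential (\<lambda>_. initial_state) v)"
    using Suc.IH \<alpha>_bounds by (intro mult_left_mono) auto
  finally show ?case
    by simp
qed simp

text \<open>Markov's inequality at threshold 1: on reachable configurations the potential dominates
  the indicator of being uncoloured.\<close>

lemma prob_uncoloured_le: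
  assumes "v \<in> pverts G"
  shows "measure_pmf.prob (run G t) {s. colour (s v) = None}
    \<le> (1 - \<alpha> / 20) ^ t * potential (\<lambda>_. initial_state) v"
proof -
  have "measure_pmf.prob (run G t) {s. colour (s v) = None}
      = measure_pmf.expectation (run G t) (indicator {s. colour (s v) = None})"
    by simp
  also have "\<dots> \<le> measure_pmf.expectation (run G t) (\<lambda>s. potential s v)"
  proof (intro integral_mono_AE integrable_measure_pmf_finite finite_set_run)
    show "AE s in run G t. indicator {s. colour (s v) = None} s \<le> potential s v"
      using potential_ge_1[OF valid_run]
      by (auto simp: AE_measure_pmf_iff indicator_def) (auto simp: potential_def)
  qed
  also note expectation_potential_run_le[OF assms]
  finally show ?thesis .
qed

section \<open>The initial potential and the union bound\<close>

lemma card_nbrs_le_max_degree: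
  assumes "v \<in> pverts G"
  shows "card (nbrs G v) \<le> max_degree G"
proof -
  have "out_arcs (with_proj G) v = Pair v ` nbrs G v"
    by (auto simp: out_arcs_def nbrs_def)
  then have "card (nbrs G v) = out_degree (with_proj G) v"
    by (simp add: out_degree_def card_image inj_on_def)
  also have "\<dots> \<le> max_degree G"
    unfolding max_degree_def using assms pair_finite_verts by (intro Max_ge) auto
  finally show ?thesis .
qed

lemma potential_initial_le:
  assumes "v \<in> pverts G"
  shows "potential (\<lambda>_. initial_state) v \<le> 2 * exp (101 * real (max_degree G))"
proof -
  define \<Delta> where "\<Delta> = max_degree G"
  have nbrs_le: "card (nbrs G v) \<le> \<Delta>"
    using card_nbrs_le_max_degree[OF assms] by (simp add: \<Delta>_def)
  have "(2::real) ^ active_nbrs G (\<lambda>_. initial_state) v \<le> 2 ^ \<Delta>"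
    using nbrs_le by (intro power_increasing) (auto simp: active_nbrs_def initial_state_def)
  also have "\<dots> \<le> exp 1 ^ \<Delta>"
    using exp_ge_add_one_self[of 1] by (intro power_mono) auto
  also have "\<dots> = exp (real \<Delta>)"
    by (simp add: exp_of_nat_mult[symmetric])
  finally have k: "(2::real) ^ active_nbrs G (\<lambda>_. initial_state) v \<le> exp (real \<Delta>)" .
  have "valid (\<lambda>_::'a. initial_state)"
    by (simp add: valid_def initial_state_def)
  then have b1: "1 \<le> base (\<lambda>_. initial_state) v"
    by (rule base_ge_1)
  have load: "load G (\<lambda>_. initial_state) v \<le> real \<Delta> / 2"
    using nbrs_le by (simp add: load_def weight_def initial_state_def)
  \<comment> \<open>As the base is at least 1, the exponent may be raised to 1; the resulting linear
    growth in the degree is absorbed by an exponential.\<close>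
  have "base (\<lambda>_. initial_state) v powr \<alpha> \<le> base (\<lambda>_. initial_state) v powr 1"
    using b1 \<alpha>_bounds by (intro powr_mono) auto
  also have "\<dots> = sqrt 2 * (1 + 200 * load G (\<lambda>_. initial_state) v)"
    using b1 by (simp add: base_def initial_state_def real_sqrt_divide)
  also have "\<dots> \<le> 2 * (1 + 100 * real \<Delta>)"
    using load real_sqrt_le_mono[of 2 4] by (intro mult_mono) (auto simp: load_def weight_def initial_state_def)
  also have "\<dots> \<le> 2 * exp (100 * real \<Delta>)"
    by (intro mult_left_mono exp_ge_add_one_self) auto
  finally have b: "base (\<lambda>_. initial_state) v powr \<alpha> \<le> 2 * exp (100 * real \<Delta>)" .
  have "potential (\<lambda>_. initial_state) v \<le> exp (real \<Delta>) * (2 * exp (100 * real \<Delta>))"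
    using k b by (auto simp: potential_def initial_state_def intro!: mult_mono)
  also have "\<dots> = 2 * exp (101 * real \<Delta>)"
    by (simp add: exp_add[symmetric])
  finally show ?thesis
    by (simp add: \<Delta>_def)
qed

text \<open>Since \<open>\<alpha> / 20 * (2020 / \<alpha>) = 101\<close>, the decay cancels the
  initial \<open>exp (101 * \<Delta>)\<close>, with \<Delta> the maximum degree, and leaves order
  \<open>n^(-3)\<close> for each node, hence \<open>n^(-2)\<close> after the union bound.\<close>

lemma prob_all_coloured_ge:
  defines "n \<equiv> card (pverts G)"
  shows "measure_pmf.prob (run G (nat \<lfloor>2020 / \<alpha> * (real (max_degree G) + ln (real n))\<rfloor>)) (all_coloured G)
    \<ge> 1 - 6 / real n ^ 2"
\<comment> \<open>For the empty graph the right-hand side is 1, as division by zero gives 0, and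
  success is certain.\<close>
proof (cases "n = 0")
  case True
  then have "all_coloured G = UNIV"
    using pair_finite_verts by (simp add: all_coloured_def n_def)
  then show ?thesis
    using True by simp
next
  case False
  then have n: "1 \<le> real n" "0 \<le> ln (real n)"
    by auto
  define L where "L = real (max_degree G) + ln (real n)"
  define t where "t = nat \<lfloor>2020 / \<alpha> * L\<rfloor>"
  \<comment> \<open>Rounding down loses less than one phase, which costs at most the factor
    \<open>exp 1 \<le> 3\<close>; with the 2 of the initial potential this gives the constant
    6.\<close>
  have "2020 / \<alpha> * L - 1 \<le> real t"
    unfolding t_def by linarith
  then have "\<alpha> / 20 * (2020 / \<alpha> * L - 1) \<le> \<alpha> / 20 * real t"
    using \<alpha>_bounds by (intro mult_left_mono) auto
  then have t: "101 * L - 1 \<le> \<alpha> / 20 * real t"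
    using \<alpha>_bounds by (simp add: algebra_simps)
  have "(1 - \<alpha> / 20) ^ t \<le> exp (- \<alpha> / 20) ^ t"
    using \<alpha>_bounds exp_ge_add_one_self[of "- \<alpha> / 20"] by (intro power_mono) auto
  also have "\<dots> = exp (- (\<alpha> / 20 * real t))"
    by (simp add: exp_of_nat_mult[symmetric] mult.commute)
  also have "\<dots> \<le> exp (1 + (- 101 * real (max_degree G)) + (- real 3 * ln (real n)))"
  proof -
    have "101 * L = 101 * real (max_degree G) + 101 * ln (real n)"
      by (simp add: L_def)
    \<comment> \<open>Of the available \<open>101 * ln n\<close> only \<open>3 * ln n\<close> is
      kept.\<close>
    then have "- (\<alpha> / 20 * real t) \<le> 1 + (- 101 * real (max_degree G)) + (- 3 * ln (real n))"
      using t n(2) by linarith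
    then show ?thesis
      by simp
  qed
  also have "\<dots> = exp 1 * exp (- 101 * real (max_degree G)) * (1 / real n ^ 3)"
    using n by (simp only: exp_add exp_minus exp_of_nat_mult minus_mult_left[symmetric] exp_ln)
      (simp add: inverse_eq_divide)
  also have "\<dots> \<le> 3 * exp (- 101 * real (max_degree G)) * (1 / real n ^ 3)"
    using exp_le by (intro mult_right_mono) auto
  finally have decay: "(1 - \<alpha> / 20) ^ t \<le> 3 * exp (- 101 * real (max_degree G)) * (1 / real n ^ 3)" .
  have single: "measure_pmf.prob (run G t) {s. colour (s v) = None} \<le> 6 / real n ^ 3"
    if "v \<in> pverts G" for v
  proof -
    have "measure_pmf.prob (run G t) {s. colour (s v) = None}
        \<le> (1 - \<alpha> / 20) ^ t * potential (\<lambda>_. initial_state) v"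
      by (rule prob_uncoloured_le[OF that])
    also have "\<dots> \<le> (3 * exp (- 101 * real (max_degree G)) * (1 / real n ^ 3))
        * (2 * exp (101 * real (max_degree G)))"
      using decay potential_initial_le[OF that]
      by (intro mult_mono) (auto simp: potential_def base_def load_def weight_def initial_state_def)
    also have "\<dots> = 6 / real n ^ 3"
      by (simp add: exp_minus field_simps)
    finally show ?thesis .
  qed
  have "1 - measure_pmf.prob (run G t) (all_coloured G)
      = measure_pmf.prob (run G t) (\<Union>v\<in>pverts G. {s. colour (s v) = None})"
    by (subst measure_pmf.prob_compl[symmetric])
      (auto simp: all_coloured_def intro!: arg_cong[where f = "measure_pmf.prob _"])
  also have "\<dots> \<le> (\<Sum>v\<in>pverts G. measure_pmf.prob (run G t) {s. colour (s v) = None})"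
    using pair_finite_verts by (intro measure_pmf.finite_measure_subadditive_finite) auto
  also have "\<dots> \<le> (\<Sum>v\<in>pverts G. 6 / real n ^ 3)"
    using single by (intro sum_mono)
  also have "\<dots> = 6 / real n ^ 2"
    using n by (simp add: n_def[symmetric] power2_eq_square power3_eq_cube)
  finally show ?thesis
    by (simp add: t_def L_def)
qed

end

theorem theorem3:
  shows "\<exists>(C::real) (err :: nat \<Rightarrow> real). C > 0 \<and> err \<in> o(\<lambda>n. 1 / real n) \<and>
    (\<forall>G :: 'v pair_pre_digraph. pair_graph G \<longrightarrow>
      measure_pmf.prob
        (run G (nat \<lfloor>C * (real (max_degree G) + ln (real (card (pverts G))))\<rfloor>))
        (all_coloured G)
      \<ge> 1 - err (card (pverts G)))"
proof (intro exI conjI allI impI)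
  \<comment> \<open>The witnesses \<open>2020 / \<alpha>\<close> for \<open>C\<close> and
    \<open>6 / n^2\<close> for \<open>err\<close> do not depend on \<open>G\<close>, which gives the
    uniformity over all graphs.\<close>
  show "0 < 2020 / \<alpha>"
    using \<alpha>_bounds by simp
  have "(\<lambda>n. 6 / real n) \<longlonglongrightarrow> 0"
    by (rule lim_const_over_n)
  moreover have "6 / real n ^ 2 / (1 / real n) = 6 / real n" for n
    by (simp add: power2_eq_square)
  ultimately show "(\<lambda>n. 6 / real n ^ 2) \<in> o(\<lambda>n. 1 / real n)"
    by (intro smalloI_tendsto) (auto simp: eventually_at_top_linorder simp del: divide_divide_eq_right
      intro!: exI[of _ 1])
  show "1 - 6 / real (card (pverts G)) ^ 2 \<le> measure_pmf.prob
      (run G (nat \<lfloor>2020 / \<alpha> * (real (max_degree G) + ln (real (card (pverts G))))\<rfloor>)) (all_coloured G)"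
    if "pair_graph G" for G :: "'v pair_pre_digraph"
    by (rule pair_graph.prob_all_coloured_ge[OF that])
qed

end
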